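(* The sequence $$\kappa(n)=\sup_{0<t<1/n}\left(\frac{W^{(-1)}(tn)}{W^{(-1)}(t)}\right)^{1/2}$$ is a majorizing characteristic of the space $D_{V,W}(\Omega)$, i.e. it is non-decreasing and for any random variables $\xi_1,\dots,\xi_n\in D_{V,W}(\Omega)$ $$\Big\|\max_{1\le i\le n}|\xi_i|\Big\|_{V,W}\le\kappa(n)\max_{1\le i\le n}\|\xi_i\|_{V,W}.$$
   Context: $W=\{W(x),x\in\mathbb R\}$ and $V=\{V(x),x\in\mathbb R\}$ are even functions, continuous and monotonically increasing for $x>0$, positive for $x\ne0$, such that: (1) there is $C>0$ with $W^{(-1)}(x+y)\le C(W^{(-1)}(x)+W^{(-1)}(y))$ for all $x,y>0$, where $W^{(-1)}$ is the inverse of $W$ on $x>0$; (2) there is a continuous function $Z=\{Z(x),x>0\}$, $0<Z(x)<\infty$, with $V(ax)\le Z(a)V(x)$ for all $a>0$, $x>0$; (3) $W(0)=0$. $D_{V,W}(\Omega)$ is the space of random variables $\xi$ with $\sup_{x\ge0}V(x)W^{(-1)}(P\{|\xi|>x\})<\infty$, with prenorm $\|\xi\|_{V,W}=\big(\sup_{x>0}V(x)W^{(-1)}(P\{|\xi|>x\})\big)^{1/2}$. *)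

theory Defs
  imports "HOL-Probability.Probability"
begin

text \<open>The inverse of \<open>W\<close> on the positive half-line, extended by \<open>0 \<mapsto> 0\<close> (recall \<open>W 0 = 0\<close>): the
  value at \<open>0\<close> is needed because the tail probabilities may vanish.\<close>

definition half_inv :: "(real \<Rightarrow> real) \<Rightarrow> real \<Rightarrow> real" where
  "half_inv W = inv_into {0..} W"

definition tail_prob :: "'a measure \<Rightarrow> ('a \<Rightarrow> real) \<Rightarrow> real \<Rightarrow> real" where
  "tail_prob M \<xi> x = measure M {\<omega> \<in> space M. \<bar>\<xi> \<omega>\<bar> > x}"

definition DVW_space :: "'a measure \<Rightarrow> (real \<Rightarrow> real) \<Rightarrow> (real \<Rightarrow> real) \<Rightarrow> ('a \<Rightarrow> real) set" where
  "DVW_space M V W = {\<xi> \<in> borel_measurable M.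
     bdd_above ((\<lambda>x. V x * half_inv W (tail_prob M \<xi> x)) ` {0..})}"

text \<open>A real supremum, hence meaningful only for members of \<^const>\<open>DVW_space\<close>.\<close>

definition DVW_norm :: "'a measure \<Rightarrow> (real \<Rightarrow> real) \<Rightarrow> (real \<Rightarrow> real) \<Rightarrow> ('a \<Rightarrow> real) \<Rightarrow> real" where
  "DVW_norm M V W \<xi> = sqrt (SUP x\<in>{0<..}. V x * half_inv W (tail_prob M \<xi> x))"

definition DVW_kappa :: "(real \<Rightarrow> real) \<Rightarrow> nat \<Rightarrow> real" where
  "DVW_kappa W n =
     (SUP t\<in>{0<..<1 / real n}. sqrt (half_inv W (t * real n) / half_inv W t))"

text \<open>Membership of the maximum in the space is part of the second clause, since otherwise its
  prenorm \<open>N\<close>, a real number, need not be meaningful.\<close>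

definition majorizing_characteristic ::
  "('a \<Rightarrow> real) set \<Rightarrow> (('a \<Rightarrow> real) \<Rightarrow> real) \<Rightarrow> (nat \<Rightarrow> real) \<Rightarrow> bool" where
  "majorizing_characteristic K N \<kappa> \<longleftrightarrow>
     mono_on {1..} \<kappa> \<and>
     (\<forall>n\<ge>1. \<forall>\<xi> :: nat \<Rightarrow> 'a \<Rightarrow> real. (\<forall>i\<in>{1..n}. \<xi> i \<in> K) \<longrightarrow>
        (\<lambda>\<omega>. MAX i\<in>{1..n}. \<bar>\<xi> i \<omega>\<bar>) \<in> K \<and>
        N (\<lambda>\<omega>. MAX i\<in>{1..n}. \<bar>\<xi> i \<omega>\<bar>) \<le> \<kappa> n * (MAX i\<in>{1..n}. N (\<xi> i)))"

end

theory Submission imports Defs begin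

text \<open>
  Write \<open>h\<close> for the inverse of \<open>W\<close>, an increasing bijection of the closed half-line.  Everything
  rests on one deterministic inequality (lemma \<open>half_inv_le_kappa\<close>): a probability \<open>q\<close> with
  \<open>q \<le> n * p\<close> satisfies \<open>h q \<le> (\<kappa> n)\<^sup>2 * h p\<close>.  If \<open>n * p < 1\<close>, this is the definition of \<open>\<kappa> n\<close>
  at \<open>t = p\<close>, together with monotonicity of \<open>h\<close>.  If \<open>n * p \<ge> 1\<close>, then \<open>q \<le> 1\<close> and \<open>p \<ge> 1 / n\<close>, and
  the case follows by letting \<open>t\<close> tend to the excluded end point \<open>1 / n\<close>, since \<open>h\<close> has no jump at \<open>1\<close>.

  By the union bound, the tail probability of a maximum of \<open>n\<close> variables is at most \<open>n\<close> times the
  largest of the individual tail probabilities at the same level.  Applying the inequality at each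
  level \<open>x\<close>, multiplying by \<open>V x\<close> and taking the supremum over \<open>x\<close> bounds the square of
  the prenorm, which gives both the membership of the
  maximum in the space and the stated inequality.

  Quasi-additivity of \<open>h\<close> yields \<open>h (n * t) \<le> B * h t\<close> by induction on \<open>n\<close>, so \<open>\<kappa> n\<close> is a genuine
  supremum.  That \<open>\<kappa>\<close> increases is seen by rescaling: for \<open>m \<le> n\<close> and \<open>t < 1 / m\<close>, the point
  \<open>s = t * m / n\<close> lies below \<open>1 / n\<close>, the numerators \<open>h (s * n)\<close> and \<open>h (t * m)\<close> agree, and the
  denominator \<open>h s\<close> is at most \<open>h t\<close>.
\<close>

section \<open>The inverse of an increasing bijection of the half-line\<close>

lemma strict_mono_bij_closed_half_line:
  fixes W :: "real \<Rightarrow> real"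
  assumes "mono_on {0<..} W" and bij: "bij_betw W {0<..} {0<..}" and zero: "W 0 = 0"
  shows "strict_mono_on {0..} W" and "bij_betw W {0..} {0..}"
proof -
  have "bij_betw W ({0<..} \<union> {0}) ({0<..} \<union> {W 0})"
    by (rule notIn_Un_bij_betw) (use bij zero in auto)
  moreover have "{0<..} \<union> {0} = {0::real..}"
    by auto
  ultimately show "bij_betw W {0..} {0..}"
    by (simp add: zero)
  then have inj: "inj_on W {0..}"
    by (rule bij_betw_imp_inj_on)
  have pos: "W x > 0" if "x > 0" for x
    using bij that by (auto simp: bij_betw_def)
  show "strict_mono_on {0..} W"
  proof (rule strict_mono_onI)
    fix x y :: real assume xy: "x \<in> {0..}" "y \<in> {0..}" "x < y"
    show "W x < W y"
    proof (cases "x = 0")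
      case True
      then show ?thesis using pos xy zero by auto
    next
      case False
      then have "W x \<le> W y"
        using assms(1) xy by (auto simp: mono_on_def)
      moreover have "W x \<noteq> W y"
        using inj_on_eq_iff[OF inj xy(1,2)] xy(3) by simp
      ultimately show ?thesis by simp
    qed
  qed
qed

locale half_line_bijection =
  fixes W :: "real \<Rightarrow> real"
  assumes strict_mono: "strict_mono_on {0..} W"
    and bij: "bij_betw W {0..} {0..}"
    and zero: "W 0 = 0"
begin

abbreviation h :: "real \<Rightarrow> real" where "h \<equiv> half_inv W"

lemma half_inv_nonneg: "x \<ge> 0 \<Longrightarrow> h x \<ge> 0"
  using inv_into_into[of x W "{0..}"] bij by (auto simp: half_inv_def bij_betw_def)

lemma W_half_inv: "x \<ge> 0 \<Longrightarrow> W (h x) = x"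
  using bij by (auto simp: half_inv_def bij_betw_def intro: f_inv_into_f)

lemma half_inv_W: "y \<ge> 0 \<Longrightarrow> h (W y) = y"
  using bij by (auto simp: half_inv_def bij_betw_def)

lemma half_inv_zero [simp]: "h 0 = 0"
  using half_inv_W[of 0] zero by simp

lemma half_inv_less:
  assumes "0 \<le> x" "x < y"
  shows "h x < h y"
proof (rule ccontr)
  assume "\<not> h x < h y"
  then have "W (h y) \<le> W (h x)"
    using strict_mono_on_leD[OF strict_mono, of "h y" "h x"] half_inv_nonneg assms by auto
  then show False
    using assms by (simp add: W_half_inv)
qed

lemma half_inv_mono: "0 \<le> x \<Longrightarrow> x \<le> y \<Longrightarrow> h x \<le> h y"
  using half_inv_less[of x y] by (cases "x = y") auto

lemma half_inv_pos: "x > 0 \<Longrightarrow> h x > 0"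
  using half_inv_less[of 0 x] by simp

text \<open>Left continuity of \<open>h\<close>, in the form of an upper bound: a monotone function onto an interval
  cannot jump.\<close>

lemma half_inv_le_of_left:
  assumes "y > 0" "c \<ge> 0" and left: "\<And>s. 0 < s \<Longrightarrow> s < y \<Longrightarrow> h s \<le> c"
  shows "h y \<le> c"
proof (rule ccontr)
  assume "\<not> h y \<le> c"
  then obtain u where u: "c < u" "u < h y"
    using dense[of c "h y"] by auto
  have "W u < W (h y)" "W 0 < W u"
    using strict_mono_onD[OF strict_mono, of u "h y"] strict_mono_onD[OF strict_mono, of 0 u]
      u \<open>c \<ge> 0\<close> by simp_all
  then have "h (W u) \<le> c"
    using left[of "W u"] \<open>y > 0\<close> zero by (simp add: W_half_inv)
  then show False
    using u \<open>c \<ge> 0\<close> by (simp add: half_inv_W)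
qed

end

section \<open>The characteristic \<open>\<kappa>\<close>\<close>

locale quasi_additive_half_inv = half_line_bijection +
  assumes quasi_additive:
    "\<exists>C>0. \<forall>x>0. \<forall>y>0. half_inv W (x + y) \<le> C * (half_inv W x + half_inv W y)"
begin

lemma half_inv_multiple_le: "\<exists>B\<ge>0. \<forall>t>0. h (t * real n) \<le> B * h t"
proof (induction n)
  case 0
  then show ?case by auto
next
  case (Suc n)
  obtain C where C: "C > 0" "\<And>x y. x > 0 \<Longrightarrow> y > 0 \<Longrightarrow> h (x + y) \<le> C * (h x + h y)"
    using quasi_additive by blast
  obtain B where B: "B \<ge> 0" "\<And>t. t > 0 \<Longrightarrow> h (t * real n) \<le> B * h t"
    using Suc.IH by blast
  show ?case
  proof (cases "n = 0")
    case True
    then show ?thesis by (intro exI[of _ 1]) auto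
  next
    case False
    have "h (t * real (Suc n)) \<le> C * (B + 1) * h t" if t: "t > 0" for t
    proof -
      have "h (t * real n + t) \<le> C * (h (t * real n) + h t)"
        using C(2) t False by simp
      also have "\<dots> \<le> C * (B * h t + h t)"
        using B(2)[OF t] C(1) by simp
      finally show ?thesis
        by (simp add: algebra_simps)
    qed
    then show ?thesis
      using B(1) C(1) by (intro exI[of _ "C * (B + 1)"]) auto
  qed
qed

lemma bdd_above_kappa:
  "bdd_above ((\<lambda>t. sqrt (h (t * real n) / h t)) ` {0<..<1 / real n})"
proof -
  obtain B where B: "\<And>t. t > 0 \<Longrightarrow> h (t * real n) \<le> B * h t"
    using half_inv_multiple_le by blast
  show ?thesis
    by (rule bdd_aboveI2[where M = "sqrt B"])
      (use B half_inv_pos in \<open>auto simp: divide_le_eq\<close>)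
qed

lemma ratio_le_kappa:
  assumes "0 < t" "t < 1 / real n"
  shows "sqrt (h (t * real n) / h t) \<le> DVW_kappa W n"
  unfolding DVW_kappa_def using assms bdd_above_kappa by (intro cSUP_upper) auto

lemma kappa_nonneg:
  assumes "n \<ge> 1"
  shows "DVW_kappa W n \<ge> 0"
proof -
  have t: "0 < 1 / (2 * real n)" "1 / (2 * real n) < 1 / real n"
    using assms by (auto simp: field_simps)
  have "0 \<le> sqrt (h (1 / (2 * real n) * real n) / h (1 / (2 * real n)))"
    by (auto intro!: divide_nonneg_nonneg half_inv_nonneg)
  also have "\<dots> \<le> DVW_kappa W n"
    using ratio_le_kappa[OF t] .
  finally show ?thesis .
qed

lemma kappa_mono: "mono_on {1..} (DVW_kappa W)"
proof (rule mono_onI)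
  fix m n :: nat assume "m \<in> {1..}" "n \<in> {1..}" "m \<le> n"
  then have m: "m \<ge> 1" and n: "n \<ge> 1" and mn: "m \<le> n" by auto
  show "DVW_kappa W m \<le> DVW_kappa W n"
    unfolding DVW_kappa_def[of W m]
  proof (rule cSUP_least)
    show "{0<..<1 / real m} \<noteq> {}"
      using m by simp
  next
    fix t assume t: "t \<in> {0<..<1 / real m}"
    define s where "s = t * real m / real n"
    have s: "0 < s" "s < 1 / real n" "s \<le> t" "s * real n = t * real m"
      using t m n mn by (auto simp: s_def field_simps)
    have "sqrt (h (t * real m) / h t) \<le> sqrt (h (s * real n) / h s)"
      using s t half_inv_pos[of s] half_inv_mono[of s t] half_inv_nonneg[of "t * real m"]
      by (auto intro!: divide_left_mono mult_pos_pos half_inv_pos)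
    also have "\<dots> \<le> DVW_kappa W n"
      using s by (intro ratio_le_kappa)
    finally show "sqrt (h (t * real m) / h t) \<le> DVW_kappa W n" .
  qed
qed

lemma half_inv_multiple_le_kappa:
  assumes "0 < t" "t < 1 / real n"
  shows "h (t * real n) \<le> (DVW_kappa W n)\<^sup>2 * h t"
proof -
  have "h (t * real n) / h t \<le> (DVW_kappa W n)\<^sup>2"
    using ratio_le_kappa[OF assms] by (rule sqrt_le_D)
  then show ?thesis
    using half_inv_pos[OF assms(1)] by (simp add: divide_le_eq)
qed

text \<open>Since \<open>\<kappa> n\<close> only controls \<open>t < 1 / n\<close>, the case \<open>n * p \<ge> 1\<close> passes through the value of \<open>h\<close>
  at \<open>1\<close>; this is where \<open>q\<close> must be a probability.\<close>

lemma half_inv_le_kappa: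
  assumes n: "n \<ge> 1" and "p \<ge> 0" and q: "0 \<le> q" "q \<le> 1" "q \<le> real n * p"
  shows "h q \<le> (DVW_kappa W n)\<^sup>2 * h p"
proof -
  consider "p = 0" | "0 < p" "p < 1 / real n" | "p \<ge> 1 / real n"
    using \<open>p \<ge> 0\<close> by linarith
  then show ?thesis
  proof cases
    case 1
    then show ?thesis using q by simp
  next
    case 2
    have "h q \<le> h (p * real n)"
      using q by (intro half_inv_mono) (auto simp: mult.commute)
    also have "\<dots> \<le> (DVW_kappa W n)\<^sup>2 * h p"
      using 2 by (rule half_inv_multiple_le_kappa)
    finally show ?thesis .
  next
    case 3
    have "h q \<le> h 1"
      using q by (intro half_inv_mono) auto
    also have "h 1 \<le> (DVW_kappa W n)\<^sup>2 * h p"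
    proof (rule half_inv_le_of_left)
      fix s :: real assume s: "0 < s" "s < 1"
      have "h s = h (s / real n * real n)"
        using n by simp
      also have "\<dots> \<le> (DVW_kappa W n)\<^sup>2 * h (s / real n)"
        using s n by (intro half_inv_multiple_le_kappa) (auto simp: divide_strict_right_mono)
      also have "\<dots> \<le> (DVW_kappa W n)\<^sup>2 * h p"
      proof (intro mult_left_mono half_inv_mono)
        have "s / real n \<le> 1 / real n"
          using s by (simp add: divide_right_mono)
        with 3 show "s / real n \<le> p" by linarith
      qed (use s in auto)
      finally show "h s \<le> (DVW_kappa W n)\<^sup>2 * h p" .
    qed (use half_inv_nonneg[OF \<open>p \<ge> 0\<close>] in auto)
    finally show ?thesis .
  qed
qed

end

section \<open>Tails and prenorms of maxima\<close>

text \<open>The union bound, with the index of the largest summand made explicit.\<close>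

lemma (in prob_space) tail_prob_Max_le:
  assumes I: "finite I" "I \<noteq> {}" and meas: "\<And>i. i \<in> I \<Longrightarrow> \<xi> i \<in> borel_measurable M"
  shows "\<exists>i\<in>I. tail_prob M (\<lambda>\<omega>. MAX i\<in>I. \<bar>\<xi> i \<omega>\<bar>) x \<le> real (card I) * tail_prob M (\<xi> i) x"
proof -
  define E where "E i = {\<omega> \<in> space M. \<bar>\<xi> i \<omega>\<bar> > x}" for i
  have E: "E i \<in> events" if "i \<in> I" for i
    using meas[OF that] unfolding E_def by measurable
  have "Max ((\<lambda>i. tail_prob M (\<xi> i) x) ` I) \<in> (\<lambda>i. tail_prob M (\<xi> i) x) ` I"
    using I by (intro Max_in) auto
  then obtain j where "j \<in> I" and eq: "Max ((\<lambda>i. tail_prob M (\<xi> i) x) ` I) = tail_prob M (\<xi> j) x"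
    by blast
  have le: "tail_prob M (\<xi> i) x \<le> tail_prob M (\<xi> j) x" if "i \<in> I" for i
    unfolding eq[symmetric] using I that by (intro Max_ge) auto
  have "\<bar>(MAX i\<in>I. \<bar>\<xi> i \<omega>\<bar>)\<bar> > x \<longleftrightarrow> (\<exists>i\<in>I. \<bar>\<xi> i \<omega>\<bar> > x)" for \<omega>
  proof -
    obtain i where "i \<in> I"
      using I by blast
    then have "0 \<le> (MAX i\<in>I. \<bar>\<xi> i \<omega>\<bar>)"
      using I by (subst Max_ge_iff) auto
    then show ?thesis
      using I by (simp add: Max_gr_iff)
  qed
  then have "tail_prob M (\<lambda>\<omega>. MAX i\<in>I. \<bar>\<xi> i \<omega>\<bar>) x = prob (\<Union>i\<in>I. E i)"
    unfolding tail_prob_def by (intro arg_cong[where f = prob]) (auto simp: E_def)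
  also have "\<dots> \<le> (\<Sum>i\<in>I. prob (E i))"
    using I E by (intro finite_measure_subadditive_finite) auto
  also have "\<dots> \<le> real (card I) * tail_prob M (\<xi> j) x"
    using le by (intro sum_bounded_above) (simp add: E_def tail_prob_def)
  finally show ?thesis
    using \<open>j \<in> I\<close> by blast
qed

locale DVW = prob_space M + quasi_additive_half_inv W
  for M :: "'a measure" and W :: "real \<Rightarrow> real" +
  fixes V :: "real \<Rightarrow> real"
  assumes V_pos: "\<And>x. x > 0 \<Longrightarrow> V x > 0"
begin

lemma weighted_tail_nonneg: "x > 0 \<Longrightarrow> V x * h (tail_prob M \<xi> x) \<ge> 0"
  using V_pos[of x] half_inv_nonneg by (simp add: tail_prob_def)

lemma weighted_tail_le_norm:
  assumes "\<xi> \<in> DVW_space M V W" "x > 0"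
  shows "V x * h (tail_prob M \<xi> x) \<le> (DVW_norm M V W \<xi>)\<^sup>2"
proof -
  have "bdd_above ((\<lambda>x. V x * h (tail_prob M \<xi> x)) ` {0<..})"
    using assms by (auto simp: DVW_space_def intro: bdd_above_mono)
  then have le: "V x * h (tail_prob M \<xi> x) \<le> (SUP x\<in>{0<..}. V x * h (tail_prob M \<xi> x))"
    using assms by (intro cSUP_upper) auto
  with weighted_tail_nonneg[OF assms(2), of \<xi>] show ?thesis
    by (simp add: DVW_norm_def)
qed

text \<open>The space is defined by a bound over \<open>x \<ge> 0\<close>, whereas the norm ranges over \<open>x > 0\<close>.  The single
  extra value at \<open>x = 0\<close> cannot destroy boundedness.\<close>

lemma DVW_spaceI_norm_le:
  assumes "\<xi> \<in> borel_measurable M" "c \<ge> 0"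
    and le: "\<And>x. x > 0 \<Longrightarrow> V x * h (tail_prob M \<xi> x) \<le> c\<^sup>2"
  shows "\<xi> \<in> DVW_space M V W" and "DVW_norm M V W \<xi> \<le> c"
proof -
  have "bdd_above ((\<lambda>x. V x * h (tail_prob M \<xi> x)) ` {0..})"
  proof (rule bdd_aboveI2)
    fix x :: real assume "x \<in> {0..}"
    then show "V x * h (tail_prob M \<xi> x) \<le> max (V 0 * h (tail_prob M \<xi> 0)) (c\<^sup>2)"
      using le[of x] by (cases "x = 0") auto
  qed
  then show "\<xi> \<in> DVW_space M V W"
    using assms(1) by (simp add: DVW_space_def)
  have "(SUP x\<in>{0<..}. V x * h (tail_prob M \<xi> x)) \<le> c\<^sup>2"
    using le by (intro cSUP_least) auto
  then show "DVW_norm M V W \<xi> \<le> c"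
    unfolding DVW_norm_def using \<open>c \<ge> 0\<close> by (rule real_le_lsqrt[rotated])
qed

lemma norm_nonneg:
  assumes "\<xi> \<in> DVW_space M V W"
  shows "DVW_norm M V W \<xi> \<ge> 0"
proof -
  have "bdd_above ((\<lambda>x. V x * h (tail_prob M \<xi> x)) ` {0<..})"
    using assms by (auto simp: DVW_space_def intro: bdd_above_mono)
  then have "0 \<le> (SUP x\<in>{0<..}. V x * h (tail_prob M \<xi> x))"
    using weighted_tail_nonneg[of 1 \<xi>] by (intro cSUP_upper2[where x = 1]) auto
  then show ?thesis
    by (simp add: DVW_norm_def)
qed

lemma Max_in_space_norm_le:
  assumes n: "n \<ge> 1" and \<xi>: "\<And>i. i \<in> {1..n} \<Longrightarrow> \<xi> i \<in> DVW_space M V W"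
  defines "Y \<equiv> \<lambda>\<omega>. MAX i\<in>{1..n}. \<bar>\<xi> i \<omega>\<bar>"
    and "b \<equiv> MAX i\<in>{1..n}. DVW_norm M V W (\<xi> i)"
  shows "Y \<in> DVW_space M V W" and "DVW_norm M V W Y \<le> DVW_kappa W n * b"
proof -
  let ?\<kappa> = "DVW_kappa W n"
  have meas: "\<xi> i \<in> borel_measurable M" if "i \<in> {1..n}" for i
    using \<xi>[OF that] by (simp add: DVW_space_def)
  have norm_le: "DVW_norm M V W (\<xi> i) \<le> b" if "i \<in> {1..n}" for i
    unfolding b_def using that by (intro Max_ge) auto
  have "0 \<le> DVW_norm M V W (\<xi> 1)" "DVW_norm M V W (\<xi> 1) \<le> b"
    using n by (auto intro!: norm_nonneg \<xi> norm_le)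
  then have b: "b \<ge> 0" by linarith
  have Y_meas: "Y \<in> borel_measurable M"
    unfolding Y_def by (rule borel_measurable_Max) (use n meas in auto)
  have c: "0 \<le> ?\<kappa> * b"
    using b kappa_nonneg[OF n] by simp
  have le: "V x * h (tail_prob M Y x) \<le> (?\<kappa> * b)\<^sup>2" if x: "x > 0" for x
  proof -
    have "\<exists>i\<in>{1..n}. tail_prob M Y x \<le> real (card {1..n}) * tail_prob M (\<xi> i) x"
      unfolding Y_def using n meas by (intro tail_prob_Max_le) auto
    then obtain i where i: "i \<in> {1..n}" "tail_prob M Y x \<le> real n * tail_prob M (\<xi> i) x"
      by auto
    have "h (tail_prob M Y x) \<le> ?\<kappa>\<^sup>2 * h (tail_prob M (\<xi> i) x)"
      using n i(2) by (intro half_inv_le_kappa) (auto simp: tail_prob_def)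
    then have "V x * h (tail_prob M Y x) \<le> V x * (?\<kappa>\<^sup>2 * h (tail_prob M (\<xi> i) x))"
      using V_pos[OF x] by (intro mult_left_mono) auto
    also have "\<dots> = ?\<kappa>\<^sup>2 * (V x * h (tail_prob M (\<xi> i) x))"
      by simp
    also have "\<dots> \<le> ?\<kappa>\<^sup>2 * (DVW_norm M V W (\<xi> i))\<^sup>2"
      using weighted_tail_le_norm[OF \<xi>[OF i(1)] x] by (intro mult_left_mono) auto
    also have "\<dots> \<le> ?\<kappa>\<^sup>2 * b\<^sup>2"
      using norm_le[OF i(1)] norm_nonneg[OF \<xi>[OF i(1)]]
      by (intro mult_left_mono power_mono) auto
    finally show ?thesis
      by (simp add: power_mult_distrib)
  qed
  show "Y \<in> DVW_space M V W" "DVW_norm M V W Y \<le> ?\<kappa> * b"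
    using DVW_spaceI_norm_le[OF Y_meas c le] by auto
qed

end

section \<open>The characteristic is majorizing\<close>

theorem theorem6p2:
  fixes M :: "'a measure" and V W :: "real \<Rightarrow> real"
  assumes "prob_space M"
    and V_even: "\<And>x. V (- x) = V x"
    and V_cont: "continuous_on {0<..} V"
    and V_mono: "mono_on {0<..} V"
    and V_pos: "\<And>x. x \<noteq> 0 \<Longrightarrow> V x > 0"
    and W_even: "\<And>x. W (- x) = W x"
    and W_cont: "continuous_on {0<..} W"
    and W_mono: "mono_on {0<..} W"
    and W_pos: "\<And>x. x \<noteq> 0 \<Longrightarrow> W x > 0"
    and W_invertible: "bij_betw W {0<..} {0<..}"
    and W_inv_quasi_additive:
      "\<exists>C>0. \<forall>x>0. \<forall>y>0. half_inv W (x + y) \<le> C * (half_inv W x + half_inv W y)"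
    and V_dilation:
      "\<exists>Z :: real \<Rightarrow> real. continuous_on {0<..} Z \<and> (\<forall>a>0. Z a > 0) \<and>
         (\<forall>a>0. \<forall>x>0. V (a * x) \<le> Z a * V x)"
    and W_zero: "W 0 = 0"
  shows "(\<forall>n\<ge>1. bdd_above ((\<lambda>t. sqrt (half_inv W (t * real n) / half_inv W t)) ` {0<..<1 / real n})) \<and>
    majorizing_characteristic (DVW_space M V W) (DVW_norm M V W) (DVW_kappa W)"
proof -
  interpret DVW M W V
  proof (intro DVW.intro quasi_additive_half_inv.intro half_line_bijection.intro
      quasi_additive_half_inv_axioms.intro DVW_axioms.intro)
    show "strict_mono_on {0..} W" "bij_betw W {0..} {0..}"
      using strict_mono_bij_closed_half_line[OF W_mono W_invertible W_zero] .
  qed (use assms in auto)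
  show ?thesis
    unfolding majorizing_characteristic_def
  proof (intro conjI allI impI)
    show "bdd_above ((\<lambda>t. sqrt (h (t * real n) / h t)) ` {0<..<1 / real n})" for n
      by (rule bdd_above_kappa)
    show "mono_on {1..} (DVW_kappa W)"
      by (rule kappa_mono)
  next
    fix n :: nat and \<xi> :: "nat \<Rightarrow> 'a \<Rightarrow> real"
    assume "n \<ge> 1" and \<xi>: "\<forall>i\<in>{1..n}. \<xi> i \<in> DVW_space M V W"
    then show "(\<lambda>\<omega>. MAX i\<in>{1..n}. \<bar>\<xi> i \<omega>\<bar>) \<in> DVW_space M V W"
      by (intro Max_in_space_norm_le(1)) auto
    show "DVW_norm M V W (\<lambda>\<omega>. MAX i\<in>{1..n}. \<bar>\<xi> i \<omega>\<bar>)
        \<le> DVW_kappa W n * (MAX i\<in>{1..n}. DVW_norm M V W (\<xi> i))"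
      using \<open>n \<ge> 1\<close> \<xi> by (intro Max_in_space_norm_le(2)) auto
  qed
qed

end
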